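(* Let $f:\mathbb{R}^n\to\mathbb{R}$, $g:\mathbb{R}^n\to\mathbb{R}^m$, $h:\mathbb{R}^n\to\mathbb{R}^p$ be continuously differentiable and let $\kappa$ be a nonnegative integer. Let $(t^k)_{k\in\mathbb{N}}$ be a sequence with $t^k>0$ for all $k\in\mathbb{N}$ and $t^k\downarrow 0$. For each $k$ let $(x^k,y^k)\in\mathbb{R}^n\times\mathbb{R}^n$ be a KKT point of the regularized problem $\mathrm{NLP}(t^k)$, and suppose that the sequence $(x^k,y^k)_k$ converges to $(x^*,y^* )$. If CC-MFCQ holds at $(x^*,y^* )$, then $(x^*,y^* )$ is an S-stationary point of problem (P).
   Context: Notation: $e\in\mathbb{R}^n$ is the vector of all ones, $e_i$ the $i$-th unit vector of $\mathbb{R}^n$, $x\circ y$ the componentwise product; vector inequalities are componentwise. $I_g(x)=\{i\mid g_i(x)=0\}$ and $I_0(x)=\{i\mid x_i=0\}$. Problem (P) (continuous reformulation of the cardinality constrained problem $\min f(x)$ s.t. $g(x)\le 0$, $h(x)=0$, $|\{i: x_i\ne 0\}|\le\kappa$): $$\min_{x,y\in\mathbb{R}^n} f(x)\quad\text{s.t.}\quad g(x)\le 0,\ h(x)=0,\ 0\le y\le e,\ x\circ y=0,\ e^\top y\ge n-\kappa.$$ Regularized problem $\mathrm{NLP}(t)$ for $t>0$: $$\min_{x,y\in\mathbb{R}^n} f(x)\quad\text{s.t.}\quad g(x)\le 0,\ h(x)=0,\ 0\le y\le e,\ -te\le x\circ y\le te,\ e^\top y\ge n-\kappa.$$ A KKT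 point of $\mathrm{NLP}(t)$ is a feasible point $(x,y)$ of $\mathrm{NLP}(t)$ for which there exist Lagrange multipliers satisfying the usual KKT conditions of this smooth nonlinear program in the variables $(x,y)$. S-stationarity: a point $(x^*,y^* )$ feasible for (P) is S-stationary if there exist $\lambda\in\mathbb{R}^m$, $\mu\in\mathbb{R}^p$, $\gamma\in\mathbb{R}^n$ such that $$\nabla f(x^* )+\sum_{i=1}^m\lambda_i\nabla g_i(x^* )+\sum_{i=1}^p\mu_i\nabla h_i(x^* )+\sum_{i=1}^n\gamma_i e_i=0,$$ $\lambda_i\ge 0$ and $\lambda_i g_i(x^* )=0$ for all $i=1,\dots,m$, and $\gamma_i=0$ for all $i$ with $y_i^*=0$. CC-MFCQ (Cardinality Constrained Mangasarian-Fromovitz Constraint Qualification): a point $(x^*,y^* )$ feasible for (P) satisfies CC-MFCQ if the gradients $\nabla g_i(x^* )$ $(i\in I_g(x^* ))$ and $\nabla h_i(x^* )$ $(i=1,\dots,p)$, $e_i$ $(i\in I_0(x^* ))$ are positively linearly independent, i.e. there are no multipliers $\lambda_i\ge 0$ $(i\in I_g(x^* ))$, $\mu_i\in\mathbb{R}$ $(i=1,\dots,p)$, $\gamma_i\in\mathbb{R}$ $(i\in I_0(x^* ))$ with $(\lambda,\mu,\gamma)\ne 0$ and $$\sum_{i\in I_g(x^* )}\lambda_i\nabla g_i(x^* )+\sum_{i=1}^p\mu_i\nabla h_i(x^* )+\sum_{i\in I_0(x^* )}\gamma_i e_i=0.$$ *)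

theory Defs
  imports "HOL-Analysis.Analysis"
begin

definition grad :: "('a::real_inner \<Rightarrow> real) \<Rightarrow> 'a \<Rightarrow> 'a" where
  "grad F z = (THE D. GDERIV F z :> D)"

definition cont_differentiable :: "('a::real_inner \<Rightarrow> real) \<Rightarrow> bool" where
  "cont_differentiable F \<longleftrightarrow>
     (\<exists>F'. (\<forall>z. GDERIV F z :> F' z) \<and> continuous_on UNIV F')"

text \<open>KKT points of a general smooth nonlinear program: minimise \<open>F z\<close> subject to
  \<open>G i z \<le> 0\<close> for \<open>i \<in> I\<close> and \<open>H j z = 0\<close> for \<open>j \<in> J\<close>, with \<open>I\<close> and \<open>J\<close> finite.\<close>

definition KKT_point ::
  "('a::real_inner \<Rightarrow> real) \<Rightarrow> 'i set \<Rightarrow> ('i \<Rightarrow> 'a \<Rightarrow> real) \<Rightarrow> 'j set \<Rightarrow> ('j \<Rightarrow> 'a \<Rightarrow> real)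
     \<Rightarrow> 'a \<Rightarrow> bool" where
  "KKT_point F I G J H z \<longleftrightarrow>
     (\<forall>i\<in>I. G i z \<le> 0) \<and> (\<forall>j\<in>J. H j z = 0) \<and>
     (\<exists>lam \<mu>. grad F z + (\<Sum>i\<in>I. lam i *\<^sub>R grad (G i) z) + (\<Sum>j\<in>J. \<mu> j *\<^sub>R grad (H j) z) = 0 \<and>
            (\<forall>i\<in>I. lam i \<ge> 0 \<and> lam i * G i z = 0))"

text \<open>The maps \<open>g : \<real>\<^sup>n \<rightarrow> \<real>\<^sup>m\<close> and \<open>h : \<real>\<^sup>n \<rightarrow> \<real>\<^sup>p\<close> are given by their components
  \<open>g i\<close> for \<open>i < m\<close> and \<open>h j\<close> for \<open>j < p\<close>, so that \<open>m = 0\<close> and \<open>p = 0\<close> are allowed;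
  values of \<open>g\<close> and \<open>h\<close> at other indices are never used.\<close>

definition P_feasible ::
  "nat \<Rightarrow> (nat \<Rightarrow> real^'n \<Rightarrow> real) \<Rightarrow> nat \<Rightarrow> (nat \<Rightarrow> real^'n \<Rightarrow> real) \<Rightarrow> nat
     \<Rightarrow> real^'n \<Rightarrow> real^'n \<Rightarrow> bool" where
  "P_feasible m g p h \<kappa> x y \<longleftrightarrow>
     (\<forall>i<m. g i x \<le> 0) \<and> (\<forall>j<p. h j x = 0) \<and>
     (\<forall>i. 0 \<le> y $ i \<and> y $ i \<le> 1) \<and> (\<forall>i. x $ i * y $ i = 0) \<and>
     (\<Sum>i\<in>UNIV. y $ i) \<ge> real CARD('n) - real \<kappa>"

text \<open>Labels for the scalar inequality constraints of \<open>NLP(t)\<close>.\<close>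

datatype 'n nlp_ineq =
  G_le nat | Y_ge_0 'n | Y_le_1 'n | XY_ge 'n | XY_le 'n | Card_ge

definition nlp_ineqs :: "nat \<Rightarrow> 'n nlp_ineq set" where
  "nlp_ineqs m = G_le ` {..<m} \<union> range Y_ge_0 \<union> range Y_le_1 \<union> range XY_ge \<union> range XY_le \<union> {Card_ge}"

fun nlp_ineq_fun ::
  "(nat \<Rightarrow> real^'n \<Rightarrow> real) \<Rightarrow> nat \<Rightarrow> real \<Rightarrow> 'n nlp_ineq \<Rightarrow> (real^'n) \<times> (real^'n) \<Rightarrow> real" where
  "nlp_ineq_fun g \<kappa> t (G_le i) (x, y) = g i x"
| "nlp_ineq_fun g \<kappa> t (Y_ge_0 i) (x, y) = - y $ i"
| "nlp_ineq_fun g \<kappa> t (Y_le_1 i) (x, y) = y $ i - 1"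
| "nlp_ineq_fun g \<kappa> t (XY_ge i) (x, y) = - t - x $ i * y $ i"
| "nlp_ineq_fun g \<kappa> t (XY_le i) (x, y) = x $ i * y $ i - t"
| "nlp_ineq_fun g \<kappa> t Card_ge (x, y) = real CARD('n) - real \<kappa> - (\<Sum>i\<in>UNIV. y $ i)"

definition NLP_KKT_point ::
  "(real^'n \<Rightarrow> real) \<Rightarrow> nat \<Rightarrow> (nat \<Rightarrow> real^'n \<Rightarrow> real) \<Rightarrow> nat \<Rightarrow> (nat \<Rightarrow> real^'n \<Rightarrow> real) \<Rightarrow> nat
     \<Rightarrow> real \<Rightarrow> real^'n \<Rightarrow> real^'n \<Rightarrow> bool" where
  "NLP_KKT_point f m g p h \<kappa> t x y \<longleftrightarrow>
     KKT_point (\<lambda>(u, v). f u) (nlp_ineqs m) (nlp_ineq_fun g \<kappa> t)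
       {..<p} (\<lambda>j (u, v). h j u) (x, y)"

definition S_stationary ::
  "(real^'n \<Rightarrow> real) \<Rightarrow> nat \<Rightarrow> (nat \<Rightarrow> real^'n \<Rightarrow> real) \<Rightarrow> nat \<Rightarrow> (nat \<Rightarrow> real^'n \<Rightarrow> real) \<Rightarrow> nat
     \<Rightarrow> real^'n \<Rightarrow> real^'n \<Rightarrow> bool" where
  "S_stationary f m g p h \<kappa> x y \<longleftrightarrow>
     P_feasible m g p h \<kappa> x y \<and>
     (\<exists>(lam::nat \<Rightarrow> real) (\<mu>::nat \<Rightarrow> real) (\<gamma>::real^'n).
        grad f x + (\<Sum>i<m. lam i *\<^sub>R grad (g i) x) + (\<Sum>j<p. \<mu> j *\<^sub>R grad (h j) x)
          + (\<Sum>i\<in>UNIV. \<gamma> $ i *\<^sub>R axis i 1) = 0 \<and>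
        (\<forall>i<m. lam i \<ge> 0 \<and> lam i * g i x = 0) \<and>
        (\<forall>i. y $ i = 0 \<longrightarrow> \<gamma> $ i = 0))"

definition I_g :: "nat \<Rightarrow> (nat \<Rightarrow> real^'n \<Rightarrow> real) \<Rightarrow> real^'n \<Rightarrow> nat set" where
  "I_g m g x = {i. i < m \<and> g i x = 0}"

definition I_0 :: "real^'n \<Rightarrow> 'n set" where
  "I_0 x = {i. x $ i = 0}"

text \<open>The condition involves only the \<open>x\<close>-part of a point. It is customarily considered at points
  \<open>(x, y)\<close> feasible for (P); feasibility is not made part of the predicate, so assuming
  the qualification at a point does not assume that the point is feasible.\<close>

definition CC_MFCQ ::
  "nat \<Rightarrow> (nat \<Rightarrow> real^'n \<Rightarrow> real) \<Rightarrow> nat \<Rightarrow> (nat \<Rightarrow> real^'n \<Rightarrow> real)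
     \<Rightarrow> real^'n \<Rightarrow> real^'n \<Rightarrow> bool" where
  "CC_MFCQ m g p h x y \<longleftrightarrow>
     \<not> (\<exists>(lam::nat \<Rightarrow> real) (\<mu>::nat \<Rightarrow> real) (\<gamma>::'n \<Rightarrow> real).
          (\<forall>i\<in>I_g m g x. lam i \<ge> 0) \<and>
          ((\<exists>i\<in>I_g m g x. lam i \<noteq> 0) \<or> (\<exists>j<p. \<mu> j \<noteq> 0) \<or> (\<exists>i\<in>I_0 x. \<gamma> i \<noteq> 0)) \<and>
          (\<Sum>i\<in>I_g m g x. lam i *\<^sub>R grad (g i) x) + (\<Sum>j<p. \<mu> j *\<^sub>R grad (h j) x)
            + (\<Sum>i\<in>I_0 x. \<gamma> i *\<^sub>R axis i 1) = 0)"

end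

theory Submission
  imports Defs
begin

text \<open>
  Let \<open>\<sigma>\<close> and \<open>\<tau>\<close> be the multipliers of \<open>- t e \<le> x \<circ> y\<close> and \<open>x \<circ> y \<le> t e\<close>; they contribute
  \<open>\<gamma>\<^sub>i e\<^sub>i\<close> with \<open>\<gamma>\<^sub>i = (\<tau>\<^sub>i - \<sigma>\<^sub>i) y\<^sub>i\<close> to the stationarity equation in \<open>x\<close>. If some such \<open>\<gamma>\<^sub>i\<close> with
  \<open>y\<^sub>i < 1\<close> is nonzero, the equation in \<open>y\<close> forces the multiplier \<open>\<delta>\<close> of the cardinality constraint
  to be positive and gives \<open>\<bar>\<gamma>\<^sub>j\<bar> = \<delta> y\<^sub>j\<^sup>2 / t\<close> for all \<open>j\<close> with \<open>y\<^sub>j < 1\<close>. As that constraint is then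
  active, these \<open>y\<^sub>j\<close> sum to a positive integer, so one of them is at least \<open>1 / n\<close> and
  \<open>\<bar>\<gamma>\<^sub>i\<bar> \<le> n\<^sup>2 y\<^sub>i\<^sup>2 \<bar>\<gamma>\<^sub>j\<bar>\<close> for this \<open>j\<close>. Hence \<open>\<gamma>\<^sub>i\<close> is negligible relative to all multipliers wherever
  \<open>y\<^sub>i\<close> tends to 0. Normalising the multipliers, including the coefficient 1 of the objective,
  and passing to a subsequence yields a nontrivial Fritz John system at the limit; CC-MFCQ says
  that its objective coefficient is nonzero, and dividing by it gives S-stationarity.
\<close>

section \<open>Compactness and an estimate for abstract multipliers\<close>

lemma finite_subsequence_convergent:
  fixes u :: "nat \<Rightarrow> 's \<Rightarrow> real"
  assumes "finite S" "\<And>s. s \<in> S \<Longrightarrow> bounded (range (\<lambda>k. u k s))"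
  shows "\<exists>r l. strict_mono (r :: nat \<Rightarrow> nat) \<and> (\<forall>s\<in>S. (\<lambda>k. u (r k) s) \<longlonglongrightarrow> l s)"
  using assms
proof (induction S rule: finite_induct)
  case empty
  show ?case by (auto intro: exI[of _ id] simp: strict_mono_def)
next
  \<comment> \<open>Bolzano-Weierstrass one coordinate at a time: the subsequence found for
    \<open>S\<close> is thinned once more for \<open>a\<close>, which does not disturb the limits
    already obtained.\<close>
  case (insert a S)
  then obtain r l where r: "strict_mono (r :: nat \<Rightarrow> nat)"
    and l: "\<And>s. s \<in> S \<Longrightarrow> (\<lambda>k. u (r k) s) \<longlonglongrightarrow> l s"
    by blast
  have "bounded (range (\<lambda>k. u (r k) a))"
    by (rule bounded_subset[OF insert.prems[of a]]) auto
  then obtain b q where q: "strict_mono (q :: nat \<Rightarrow> nat)" and b: "(\<lambda>k. u (r (q k)) a) \<longlonglongrightarrow> b"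
    using bounded_imp_convergent_subsequence[of "\<lambda>k. u (r k) a"] by (auto simp: o_def)
  have "(\<lambda>k. u ((r \<circ> q) k) s) \<longlonglongrightarrow> (l(a := b)) s" if "s \<in> insert a S" for s
    using that b LIMSEQ_subseq_LIMSEQ[OF l q] by (cases "s = a") (auto simp: o_def)
  then show ?case
    using strict_mono_o[OF r q] by blast
qed

text \<open>Dividing by the sum of absolute values puts all coefficients into [-1, 1], so a
  subsequence converges. The dependence and the normalisation are finite sums and survive the limit,
  so the limiting dependence is nontrivial. The individual limits are recorded too, so that signs,
  complementarity and smallness of single coefficients can be transferred.\<close>

lemma normalised_coefficients_limit:
  fixes S :: "'s set"
    and v :: "nat \<Rightarrow> 's \<Rightarrow> 'a::real_normed_vector"
    and c :: "nat \<Rightarrow> 's \<Rightarrow> real"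
  defines "N \<equiv> \<lambda>k. \<Sum>s\<in>S. \<bar>c k s\<bar>"
  assumes S: "finite S"
    and v: "\<And>s. s \<in> S \<Longrightarrow> (\<lambda>k. v k s) \<longlonglongrightarrow> V s"
    and dep: "\<And>k. (\<Sum>s\<in>S. c k s *\<^sub>R v k s) = 0"
    and pos: "\<And>k. N k > 0"
  shows "\<exists>r d. strict_mono (r :: nat \<Rightarrow> nat) \<and>
    (\<forall>s\<in>S. (\<lambda>k. c (r k) s / N (r k)) \<longlonglongrightarrow> d s) \<and>
    (\<Sum>s\<in>S. d s *\<^sub>R V s) = 0 \<and> (\<Sum>s\<in>S. \<bar>d s\<bar>) = 1"
proof -
  have "\<bar>c k s / N k\<bar> \<le> 1" if "s \<in> S" for k s
    using member_le_sum[of s S "\<lambda>s. \<bar>c k s\<bar>"] that S pos[of k]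
    by (simp add: N_def abs_of_pos divide_le_eq)
  then have "\<And>s. s \<in> S \<Longrightarrow> bounded (range (\<lambda>k. c k s / N k))"
    by (intro boundedI[of _ 1]) auto
  from finite_subsequence_convergent[of S "\<lambda>k s. c k s / N k", OF S this]
  obtain r d where r: "strict_mono (r :: nat \<Rightarrow> nat)"
    and d: "\<And>s. s \<in> S \<Longrightarrow> (\<lambda>k. c (r k) s / N (r k)) \<longlonglongrightarrow> d s"
    by blast
  have "(\<lambda>k. \<Sum>s\<in>S. (c (r k) s / N (r k)) *\<^sub>R v (r k) s) \<longlonglongrightarrow> (\<Sum>s\<in>S. d s *\<^sub>R V s)"
    using LIMSEQ_subseq_LIMSEQ[OF v r] by (intro tendsto_sum tendsto_scaleR d) (auto simp: o_def)
  moreover have "(\<Sum>s\<in>S. (c k s / N k) *\<^sub>R v k s) = 0" for k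
  proof -
    have "(\<Sum>s\<in>S. (c k s / N k) *\<^sub>R v k s) = (1 / N k) *\<^sub>R (\<Sum>s\<in>S. c k s *\<^sub>R v k s)"
      by (simp add: scaleR_sum_right)
    then show ?thesis by (simp add: dep)
  qed
  ultimately have 1: "(\<Sum>s\<in>S. d s *\<^sub>R V s) = 0"
    by (simp add: LIMSEQ_const_iff)
  have "(\<lambda>k. \<Sum>s\<in>S. \<bar>c (r k) s / N (r k)\<bar>) \<longlonglongrightarrow> (\<Sum>s\<in>S. \<bar>d s\<bar>)"
    by (intro tendsto_sum tendsto_rabs d)
  moreover have "(\<Sum>s\<in>S. \<bar>c k s / N k\<bar>) = 1" for k
  proof -
    have "(\<Sum>s\<in>S. \<bar>c k s / N k\<bar>) = (\<Sum>s\<in>S. \<bar>c k s\<bar>) / N k"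
      using pos[of k] by (simp add: abs_divide abs_of_pos sum_divide_distrib)
    also have "\<dots> = 1" using pos[of k] by (simp add: N_def)
    finally show ?thesis .
  qed
  ultimately have 2: "(\<Sum>s\<in>S. \<bar>d s\<bar>) = 1"
    by (simp add: LIMSEQ_const_iff)
  from r d 1 2 show ?thesis by blast
qed

text \<open>Here \<open>\<alpha>\<close> and \<open>\<beta>\<close> are the multipliers of 0 \<le> y
  and y \<le> e, and \<open>K\<close> stands for n - \<kappa>. The factor in the bound does not
  involve \<open>t\<close>, so the estimate is uniform along the sequence of regularized problems.
  The index \<open>j\<close> may change from one problem to the next, because the later
  normalisation dominates every multiplier.\<close>

lemma complementarity_multiplier_bound:
  fixes x y \<alpha> \<beta> \<sigma> \<tau> :: "'n::finite \<Rightarrow> real"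
  assumes t: "t > 0"
    and y: "\<And>i. 0 \<le> y i" "\<And>i. y i \<le> 1"
    and nn: "\<And>i. \<alpha> i \<ge> 0" "\<And>i. \<sigma> i \<ge> 0" "\<And>i. \<tau> i \<ge> 0" "\<delta> \<ge> 0"
    and comp: "\<And>i. \<alpha> i * y i = 0" "\<And>i. \<beta> i * (y i - 1) = 0"
      "\<And>i. \<sigma> i * (t + x i * y i) = 0" "\<And>i. \<tau> i * (x i * y i - t) = 0"
      "\<delta> * (of_int K - (\<Sum>i\<in>UNIV. y i)) = 0"
    and stat: "\<And>i. - \<alpha> i + \<beta> i + (\<tau> i - \<sigma> i) * x i = \<delta>"
    and i: "y i < 1"
  shows "\<exists>j. \<bar>(\<tau> i - \<sigma> i) * y i\<bar> \<le> real CARD('n)^2 * (y i)^2 * \<bar>(\<tau> j - \<sigma> j) * y j\<bar>"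
proof (cases "(\<tau> i - \<sigma> i) * y i = 0")
  case True
  show ?thesis unfolding True by (rule exI[of _ i]) simp
next
  case False
  \<comment> \<open>Within this proof \<open>\<gamma>\<close> omits the factor \<open>y\<close>: the
    coefficient in the \<open>x\<close>-equation is \<open>\<gamma> j * y j\<close>.\<close>
  define \<gamma> where "\<gamma> = (\<lambda>j. \<tau> j - \<sigma> j)"
  \<comment> \<open>A nonzero difference requires an active product bound. Since
    \<open>t > 0\<close>, the two bounds cannot be active together, so \<open>\<gamma> j\<close> has
    the sign of \<open>x j\<close>; and \<open>y j\<close> cannot vanish, which kills
    \<open>\<alpha> j\<close>.\<close>
  have act: "y j > 0 \<and> \<alpha> j = 0 \<and> \<bar>x j\<bar> * y j = t \<and> \<gamma> j * x j > 0" if nz: "\<gamma> j \<noteq> 0" for j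
  proof -
    consider "\<tau> j > 0" | "\<tau> j = 0" "\<sigma> j > 0"
      using nz nn(2,3)[of j] unfolding \<gamma>_def by fastforce
    then show ?thesis
    proof cases
      case 1
      then have xy: "x j * y j = t" using comp(4)[of j] by simp
      then have "\<sigma> j = 0" using comp(3)[of j] t by simp
      moreover have "y j > 0" "x j > 0"
        using xy t y(1)[of j] zero_less_mult_iff[of "x j" "y j"] by auto
      ultimately show ?thesis using 1 xy comp(1)[of j] by (auto simp: \<gamma>_def)
    next
      case 2
      then have xy: "x j * y j = - t" using comp(3)[of j] by simp
      then have "y j > 0" "x j < 0"
        using t y(1)[of j] mult_less_0_iff[of "x j" "y j"] by auto
      then show ?thesis using 2 xy comp(1)[of j] by (auto simp: \<gamma>_def mult_pos_neg)
    qed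
  qed
  have gi: "\<gamma> i \<noteq> 0" using False by (simp add: \<gamma>_def)
  have \<beta>0: "\<beta> j = 0" if "y j < 1" for j using comp(2)[of j] that by simp
  \<comment> \<open>At index \<open>i\<close> both bound multipliers vanish, so the equation in
    \<open>y\<close> reduces to \<open>\<gamma> i * x i = \<delta>\<close> with a positive left
    side.\<close>
  have "\<delta> > 0" using stat[of i] act[OF gi] \<beta>0[OF i] by (simp add: \<gamma>_def)
  then have sumy: "(\<Sum>i\<in>UNIV. y i) = of_int K" using comp(5) by simp
  \<comment> \<open>Now \<open>\<delta> > 0\<close> makes \<open>\<gamma> j * x j\<close> positive
    whenever \<open>y j < 1\<close>, so \<open>act\<close> applies to all these indices.
    Substituting \<open>t / y j\<close> for the absolute value of \<open>x j\<close> gives the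
    formula.\<close>
  have frac: "y j > 0 \<and> \<bar>\<gamma> j * y j\<bar> = \<delta> * (y j)^2 / t" if j: "y j < 1" for j
  proof -
    have eq: "\<gamma> j * x j = \<delta> + \<alpha> j" using stat[of j] \<beta>0[OF j] by (simp add: \<gamma>_def)
    then have "\<gamma> j \<noteq> 0" using \<open>\<delta> > 0\<close> nn(1)[of j] by auto
    note a = act[OF this]
    have "\<bar>\<gamma> j\<bar> * \<bar>x j\<bar> = \<delta>" using eq a \<open>\<delta> > 0\<close> by (simp flip: abs_mult)
    then have "\<delta> * (y j)^2 = (\<bar>\<gamma> j\<bar> * y j) * (\<bar>x j\<bar> * y j)"
      by (simp add: power2_eq_square mult_ac)
    also have "\<dots> = \<bar>\<gamma> j * y j\<bar> * t" using a by (simp add: abs_mult)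
    finally have "\<bar>\<gamma> j * y j\<bar> * t = \<delta> * (y j)^2" by simp
    then show ?thesis using a t by (simp add: field_simps)
  qed
  \<comment> \<open>The components of \<open>y\<close> strictly below 1 add up to a positive integer, so one of them
    is at least \<open>1 / n\<close>.\<close>
  define A where "A = {j. y j < 1}"
  have "(\<Sum>j\<in>UNIV. y j) = (\<Sum>j\<in>A. y j) + (\<Sum>j\<in>-A. y j)"
    by (metis Compl_partition Compl_disjoint finite sum.union_disjoint)
  moreover have "(\<Sum>j\<in>-A. y j) = real (card (-A))"
  proof -
    have "y j = 1" if "j \<in> -A" for j using that y(2)[of j] by (simp add: A_def)
    then show ?thesis by simp
  qed
  ultimately have "(\<Sum>j\<in>A. y j) = of_int (K - int (card (-A)))"
    using sumy by simp
  moreover have "(\<Sum>j\<in>A. y j) > 0"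
    using frac i by (intro sum_pos2[of A i]) (auto simp: A_def y)
  ultimately have sumA: "(\<Sum>j\<in>A. y j) \<ge> 1"
    by (metis of_int_0_less_iff of_int_1_le_iff int_one_le_iff_zero_less)
  have "\<exists>j\<in>A. y j \<ge> 1 / real CARD('n)"
  proof (rule ccontr)
    assume "\<not> ?thesis"
    then have "(\<Sum>j\<in>A. y j) < (\<Sum>j\<in>A. 1 / real CARD('n))"
      using i by (intro sum_strict_mono) (auto simp: A_def)
    also have "\<dots> \<le> 1" using card_mono[of UNIV A] by (simp add: divide_le_eq)
    finally show False using sumA by simp
  qed
  then obtain j where j: "y j < 1" "1 / real CARD('n) \<le> y j" by (auto simp: A_def)
  have "1 \<le> real CARD('n) * y j" using j(2) by (simp add: field_simps)
  then have "1 \<le> (real CARD('n) * y j)^2" by simp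
  \<comment> \<open>Inserting the factor \<open>(real CARD('n) * y j)^2\<close>, which is at least
    1, brings in the value that \<open>frac\<close> gives for \<open>j\<close>.\<close>
  then have "\<delta> * (y i)^2 / t * 1 \<le> \<delta> * (y i)^2 / t * (real CARD('n) * y j)^2"
    using t \<open>\<delta> > 0\<close> by (intro mult_left_mono) auto
  then have "\<delta> * (y i)^2 / t \<le> real CARD('n)^2 * (y i)^2 * (\<delta> * (y j)^2 / t)"
    by (simp add: power_mult_distrib mult_ac)
  then show ?thesis using frac[OF i] frac[OF j(1)] unfolding \<gamma>_def by metis
qed

section \<open>Gradients of the functions defining NLP(t)\<close>

lemma grad_eqI: "grad F z = D" if "GDERIV F z :> D"
proof -
  \<comment> \<open>The definite description in \<open>grad\<close> calls for uniqueness: equal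
    derivatives are equal inner product functionals, hence come from the same vector.\<close>
  have "E = D" if "GDERIV F z :> E" for E
  proof -
    have "(\<lambda>h. inner h E) = (\<lambda>h. inner h D)"
      using that \<open>GDERIV F z :> D\<close> unfolding gderiv_def by (rule has_derivative_unique)
    then show ?thesis by (metis inner_commute vector_eq_ldot)
  qed
  then show ?thesis unfolding grad_def using that by blast
qed

lemma cont_differentiable_GDERIV: "GDERIV F z :> grad F z" if "cont_differentiable F"
  using that grad_eqI unfolding cont_differentiable_def by metis

lemma cont_differentiable_isCont: "isCont F z" if "cont_differentiable F"
  using cont_differentiable_GDERIV[OF that] unfolding gderiv_def by (rule has_derivative_continuous)

lemma cont_differentiable_isCont_grad: "isCont (grad F) z" if F: "cont_differentiable F"
proof -
  obtain F' where F': "\<And>z. GDERIV F z :> F' z" and "continuous_on UNIV F'"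
    using F unfolding cont_differentiable_def by blast
  moreover have "grad F = F'" using grad_eqI[OF F'] by blast
  ultimately show ?thesis by (simp add: continuous_on_eq_continuous_at)
qed

lemma grad_fst: "grad (\<lambda>(u, v). F u) (x, y) = (grad F x, 0)" if "cont_differentiable F"
proof (rule grad_eqI)
  have "(F has_derivative (\<lambda>h. inner h (grad F x))) (at (fst (x, y)))"
    using cont_differentiable_GDERIV[OF that, of x] by (simp add: gderiv_def)
  then show "GDERIV (\<lambda>(u, v). F u) (x, y) :> (grad F x, 0)"
    unfolding gderiv_def case_prod_unfold
    by (auto intro!: derivative_eq_intros has_derivative_compose[of fst _ _ _ F] simp: inner_prod_def)
qed

lemma grad_nlp_ineq_fun:
  fixes g :: "nat \<Rightarrow> real^'n \<Rightarrow> real"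
  shows "cont_differentiable (g k) \<Longrightarrow> grad (nlp_ineq_fun g \<kappa> t (G_le k)) (x, y) = (grad (g k) x, 0)"
    and "grad (nlp_ineq_fun g \<kappa> t (Y_ge_0 i)) (x, y) = (0, - axis i 1)"
    and "grad (nlp_ineq_fun g \<kappa> t (Y_le_1 i)) (x, y) = (0, axis i 1)"
    and "grad (nlp_ineq_fun g \<kappa> t (XY_ge i)) (x, y) = - (y $ i *\<^sub>R axis i 1, x $ i *\<^sub>R axis i 1)"
    and "grad (nlp_ineq_fun g \<kappa> t (XY_le i)) (x, y) = (y $ i *\<^sub>R axis i 1, x $ i *\<^sub>R axis i 1)"
    and "grad (nlp_ineq_fun g \<kappa> t Card_ge) (x, y) = (0, - (\<chi> i. 1))"
proof -
  note nth = bounded_linear.has_derivative[OF bounded_linear_vec_nth]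
  \<comment> \<open>The defining equations match on pairs; the derivative rules apply to the same
    functions written with \<open>fst\<close> and \<open>snd\<close>.\<close>
  have eqs: "nlp_ineq_fun g \<kappa> t (G_le k) = (\<lambda>(u, v). g k u)"
    "nlp_ineq_fun g \<kappa> t (Y_ge_0 i) = (\<lambda>z. - snd z $ i)"
    "nlp_ineq_fun g \<kappa> t (Y_le_1 i) = (\<lambda>z. snd z $ i - 1)"
    "nlp_ineq_fun g \<kappa> t (XY_ge i) = (\<lambda>z. - t - fst z $ i * snd z $ i)"
    "nlp_ineq_fun g \<kappa> t (XY_le i) = (\<lambda>z. fst z $ i * snd z $ i - t)"
    "nlp_ineq_fun g \<kappa> t Card_ge = (\<lambda>z. real CARD('n) - real \<kappa> - (\<Sum>i\<in>UNIV. snd z $ i))"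
    by (auto simp: fun_eq_iff)
  show "cont_differentiable (g k) \<Longrightarrow> grad (nlp_ineq_fun g \<kappa> t (G_le k)) (x, y) = (grad (g k) x, 0)"
    unfolding eqs by (rule grad_fst)
  have ax: "inner v (axis i 1) = v $ i" for v :: "real^'n"
    by (simp add: inner_axis)
  show "grad (nlp_ineq_fun g \<kappa> t (Y_ge_0 i)) (x, y) = (0, - axis i 1)"
    unfolding eqs by (intro grad_eqI, unfold gderiv_def)
      (auto intro!: derivative_eq_intros nth simp: inner_prod_def ax fun_eq_iff)
  show "grad (nlp_ineq_fun g \<kappa> t (Y_le_1 i)) (x, y) = (0, axis i 1)"
    unfolding eqs by (intro grad_eqI, unfold gderiv_def)
      (auto intro!: derivative_eq_intros nth simp: inner_prod_def ax fun_eq_iff)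
  show "grad (nlp_ineq_fun g \<kappa> t (XY_ge i)) (x, y) = - (y $ i *\<^sub>R axis i 1, x $ i *\<^sub>R axis i 1)"
    unfolding eqs by (intro grad_eqI, unfold gderiv_def)
      (auto intro!: derivative_eq_intros nth simp: inner_prod_def ax fun_eq_iff)
  show "grad (nlp_ineq_fun g \<kappa> t (XY_le i)) (x, y) = (y $ i *\<^sub>R axis i 1, x $ i *\<^sub>R axis i 1)"
    unfolding eqs by (intro grad_eqI, unfold gderiv_def)
      (auto intro!: derivative_eq_intros nth simp: inner_prod_def ax fun_eq_iff)
  show "grad (nlp_ineq_fun g \<kappa> t Card_ge) (x, y) = (0, - (\<chi> i. 1))"
    unfolding eqs by (intro grad_eqI, unfold gderiv_def)
      (auto intro!: derivative_eq_intros nth simp: inner_prod_def inner_vec_def sum_negf fun_eq_iff)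
qed

section \<open>The KKT system of NLP(t) in components\<close>

lemma sum_nlp_ineqs:
  fixes F :: "'n::finite nlp_ineq \<Rightarrow> 'a::comm_monoid_add"
  shows "sum F (nlp_ineqs m) = (\<Sum>i<m. F (G_le i)) + (\<Sum>i\<in>UNIV. F (Y_ge_0 i)) +
    (\<Sum>i\<in>UNIV. F (Y_le_1 i)) + (\<Sum>i\<in>UNIV. F (XY_ge i)) + (\<Sum>i\<in>UNIV. F (XY_le i)) + F Card_ge"
proof -
  have "inj_on (G_le :: nat \<Rightarrow> 'n nlp_ineq) {..<m}" "inj (Y_ge_0 :: 'n \<Rightarrow> _)" "inj (Y_le_1 :: 'n \<Rightarrow> _)"
    "inj (XY_ge :: 'n \<Rightarrow> _)" "inj (XY_le :: 'n \<Rightarrow> _)"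
    by (auto simp: inj_on_def)
  then show ?thesis
    unfolding nlp_ineqs_def
    by (subst sum.union_disjoint, simp, simp, force)+ (simp add: sum.reindex)
qed

lemma ball_nlp_ineqs:
  "(\<forall>c\<in>nlp_ineqs m. Q c) \<longleftrightarrow> (\<forall>i<m. Q (G_le i)) \<and> (\<forall>i. Q (Y_ge_0 i)) \<and> (\<forall>i. Q (Y_le_1 i)) \<and>
    (\<forall>i. Q (XY_ge i)) \<and> (\<forall>i. Q (XY_le i)) \<and> Q Card_ge"
  unfolding nlp_ineqs_def by auto

lemma NLP_KKT_point_feasible:
  fixes x y :: "real^'n"
  assumes "NLP_KKT_point f m g p h \<kappa> t x y"
  shows "i < m \<Longrightarrow> g i x \<le> 0" and "j < p \<Longrightarrow> h j x = 0"
    and "0 \<le> y $ l" and "y $ l \<le> 1" and "\<bar>x $ l * y $ l\<bar> \<le> t"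
    and "real CARD('n) - real \<kappa> \<le> (\<Sum>i\<in>UNIV. y $ i)"
proof -
  have "\<forall>c\<in>nlp_ineqs m. nlp_ineq_fun g \<kappa> t c (x, y) \<le> 0" and h: "\<forall>j<p. h j x = 0"
    using assms unfolding NLP_KKT_point_def KKT_point_def by auto
  then have *: "\<forall>i<m. g i x \<le> 0" "\<forall>i. 0 \<le> y $ i" "\<forall>i. y $ i \<le> 1"
    "\<forall>i. - t \<le> x $ i * y $ i" "\<forall>i. x $ i * y $ i \<le> t"
    "real CARD('n) - real \<kappa> \<le> (\<Sum>i\<in>UNIV. y $ i)"
    unfolding ball_nlp_ineqs by (auto simp: algebra_simps)
  show "i < m \<Longrightarrow> g i x \<le> 0" "j < p \<Longrightarrow> h j x = 0" "0 \<le> y $ l" "y $ l \<le> 1"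
    "real CARD('n) - real \<kappa> \<le> (\<Sum>i\<in>UNIV. y $ i)"
    using * h by blast+
  show "\<bar>x $ l * y $ l\<bar> \<le> t"
    using *(4)[rule_format, of l] *(5)[rule_format, of l] by linarith
qed

text \<open>The first component of the stationarity equation is the equation in \<open>x\<close>.
  The second component supplies the hypotheses of \<open>complementarity_multiplier_bound\<close>,
  and the resulting estimate is all that is retained of the multipliers acting on
  \<open>y\<close>.\<close>

lemma NLP_KKT_point_multipliers:
  fixes x y :: "real^'n"
  assumes f: "cont_differentiable f"
    and g: "\<And>i. i < m \<Longrightarrow> cont_differentiable (g i)"
    and h: "\<And>j. j < p \<Longrightarrow> cont_differentiable (h j)"
    and t: "t > 0"
    and KKT: "NLP_KKT_point f m g p h \<kappa> t x y"
  shows "\<exists>lam \<mu> (\<gamma> :: 'n \<Rightarrow> real).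
    grad f x + (\<Sum>i<m. lam i *\<^sub>R grad (g i) x) + (\<Sum>j<p. \<mu> j *\<^sub>R grad (h j) x)
      + (\<Sum>i\<in>UNIV. \<gamma> i *\<^sub>R axis i 1) = 0 \<and>
    (\<forall>i<m. lam i \<ge> 0 \<and> lam i * g i x = 0) \<and>
    (\<forall>i. y $ i < 1 \<longrightarrow> (\<exists>j. \<bar>\<gamma> i\<bar> \<le> real CARD('n)^2 * (y $ i)^2 * \<bar>\<gamma> j\<bar>))"
proof -
  let ?G = "nlp_ineq_fun g \<kappa> t"
  obtain l \<mu> where
    stat: "grad (\<lambda>(u, v). f u) (x, y) + (\<Sum>c\<in>nlp_ineqs m. l c *\<^sub>R grad (?G c) (x, y))
      + (\<Sum>j<p. \<mu> j *\<^sub>R grad (\<lambda>(u, v). h j u) (x, y)) = 0"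
    and compl: "\<forall>c\<in>nlp_ineqs m. l c \<ge> 0 \<and> l c * ?G c (x, y) = 0"
    using KKT unfolding NLP_KKT_point_def KKT_point_def by blast
  define \<gamma> where "\<gamma> i = (l (XY_le i) - l (XY_ge i)) * y $ i" for i
  have G: "(\<Sum>i<m. l (G_le i) *\<^sub>R grad (?G (G_le i)) (x, y))
      = (\<Sum>i<m. l (G_le i) *\<^sub>R (grad (g i) x, 0))"
    using g by (intro sum.cong) (auto simp: grad_nlp_ineq_fun(1))
  have H: "(\<Sum>j<p. \<mu> j *\<^sub>R grad (\<lambda>(u, v). h j u) (x, y)) = (\<Sum>j<p. \<mu> j *\<^sub>R (grad (h j) x, 0))"
    using h by (intro sum.cong) (auto simp: grad_fst)
  note stat' = stat[unfolded sum_nlp_ineqs grad_fst[OF f] grad_nlp_ineq_fun(2-) G H]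
  have XY_ge: "l (XY_ge i) * (t + x $ i * y $ i) = 0" for i
  proof -
    have "l (XY_ge i) * (- t - x $ i * y $ i) = 0" using compl unfolding ball_nlp_ineqs by simp
    then show ?thesis unfolding ring_distribs by linarith
  qed
  have "grad f x + (\<Sum>i<m. l (G_le i) *\<^sub>R grad (g i) x) + (\<Sum>j<p. \<mu> j *\<^sub>R grad (h j) x)
      + (\<Sum>i\<in>UNIV. \<gamma> i *\<^sub>R axis i 1) = 0"
    using arg_cong[OF stat', of fst]
    by (simp add: fst_sum \<gamma>_def sum_subtractf sum_negf algebra_simps)
  moreover have "\<forall>i<m. l (G_le i) \<ge> 0 \<and> l (G_le i) * g i x = 0"
    using compl unfolding ball_nlp_ineqs by simp
  \<comment> \<open>\<open>K\<close> is an integer rather than a natural number because n - \<kappa>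
    is negative when \<kappa> exceeds n.\<close>
  moreover have "\<exists>j. \<bar>\<gamma> i\<bar> \<le> real CARD('n)^2 * (y $ i)^2 * \<bar>\<gamma> j\<bar>" if "y $ i < 1" for i
    unfolding \<gamma>_def
  proof (rule complementarity_multiplier_bound[where t = t and x = "\<lambda>i. x $ i" and y = "\<lambda>i. y $ i"
        and \<alpha> = "\<lambda>i. l (Y_ge_0 i)" and \<beta> = "\<lambda>i. l (Y_le_1 i)" and \<delta> = "l Card_ge"
        and K = "int CARD('n) - int \<kappa>"])
    show "- l (Y_ge_0 i) + l (Y_le_1 i) + (l (XY_le i) - l (XY_ge i)) * x $ i = l Card_ge" for i
      using arg_cong[OF stat', of "\<lambda>z. snd z $ i"]
      by (simp add: snd_sum axis_def if_distrib[of "\<lambda>a. _ * a"] sum_negf algebra_simps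
          cong: if_cong)
  qed (use XY_ge compl t that NLP_KKT_point_feasible[OF KKT] in \<open>auto simp: ball_nlp_ineqs algebra_simps\<close>)
  ultimately show ?thesis
    by (intro exI[of _ "\<lambda>i. l (G_le i)"] exI[of _ \<mu>] exI[of _ \<gamma>]) blast
qed

section \<open>Passage to the limit\<close>

theorem theorem3p1:
  fixes f :: "real^'n \<Rightarrow> real"
    and g h :: "nat \<Rightarrow> real^'n \<Rightarrow> real"
    and m p \<kappa> :: nat
    and t :: "nat \<Rightarrow> real"
    and x y :: "nat \<Rightarrow> real^'n"
    and xs ys :: "real^'n"
  assumes "cont_differentiable f"
    and "\<And>i. i < m \<Longrightarrow> cont_differentiable (g i)"
    and "\<And>j. j < p \<Longrightarrow> cont_differentiable (h j)"
    and "\<And>k. t k > 0"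
    and "t \<longlonglongrightarrow> 0"
    and "\<And>k. NLP_KKT_point f m g p h \<kappa> (t k) (x k) (y k)"
    and "(\<lambda>k. (x k, y k)) \<longlonglongrightarrow> (xs, ys)"
    and "CC_MFCQ m g p h xs ys"
  shows "S_stationary f m g p h \<kappa> xs ys"
proof -
  note feas = NLP_KKT_point_feasible[OF assms(6)]
  have x: "x \<longlonglongrightarrow> xs" and y: "y \<longlonglongrightarrow> ys"
    using tendsto_fst[OF assms(7)] tendsto_snd[OF assms(7)] by simp_all
  have gx: "(\<lambda>k. g i (x k)) \<longlonglongrightarrow> g i xs" if "i < m" for i
    using isCont_tendsto_compose[OF cont_differentiable_isCont[OF assms(2)[OF that]] x] .
  have hx: "(\<lambda>k. h j (x k)) \<longlonglongrightarrow> h j xs" if "j < p" for j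
    using isCont_tendsto_compose[OF cont_differentiable_isCont[OF assms(3)[OF that]] x] .
  have yi: "(\<lambda>k. y k $ i) \<longlonglongrightarrow> ys $ i" for i using y by (rule tendsto_vec_nth)
  have xi: "(\<lambda>k. x k $ i) \<longlonglongrightarrow> xs $ i" for i using x by (rule tendsto_vec_nth)
  have xy0: "xs $ i * ys $ i = 0" for i
  proof -
    have "(\<lambda>k. x k $ i * y k $ i) \<longlonglongrightarrow> 0"
      using feas(5) by (intro Lim_null_comparison[OF _ assms(5)]) auto
    with tendsto_mult[OF xi yi] show ?thesis by (rule LIMSEQ_unique)
  qed
  \<comment> \<open>Feasibility for (P) is part of S-stationarity and is not contained in
    \<open>CC_MFCQ\<close>. All conditions are closed and pass to the limit; the relaxed products
    become zero because \<open>t\<close> tends to 0.\<close>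
  have P_feas: "P_feasible m g p h \<kappa> xs ys"
    unfolding P_feasible_def
  proof (intro conjI allI impI)
    show "g i xs \<le> 0" if "i < m" for i
      using LIMSEQ_le_const2[OF gx[OF that]] feas(1)[OF that] by blast
    show "h j xs = 0" if "j < p" for j
      using LIMSEQ_unique[OF hx[OF that]] feas(2)[OF that] by simp
    show "0 \<le> ys $ i" "ys $ i \<le> 1" for i
      using LIMSEQ_le_const[OF yi] LIMSEQ_le_const2[OF yi] feas(3,4) by blast+
    show "xs $ i * ys $ i = 0" for i by (rule xy0)
    have "(\<lambda>k. \<Sum>i\<in>UNIV. y k $ i) \<longlonglongrightarrow> (\<Sum>i\<in>UNIV. ys $ i)" by (intro tendsto_sum yi)
    then show "real CARD('n) - real \<kappa> \<le> (\<Sum>i\<in>UNIV. ys $ i)"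
      using LIMSEQ_le_const feas(6) by blast
  qed
  define KKT where "KKT k lam \<mu> \<gamma> \<longleftrightarrow>
    grad f (x k) + (\<Sum>i<m. lam i *\<^sub>R grad (g i) (x k)) + (\<Sum>j<p. \<mu> j *\<^sub>R grad (h j) (x k))
      + (\<Sum>i\<in>UNIV. \<gamma> i *\<^sub>R axis i 1) = 0 \<and>
    (\<forall>i<m. lam i \<ge> 0 \<and> lam i * g i (x k) = 0) \<and>
    (\<forall>i. y k $ i < 1 \<longrightarrow> (\<exists>j. \<bar>\<gamma> i\<bar> \<le> real CARD('n)^2 * (y k $ i)^2 * \<bar>\<gamma> j\<bar>))"
    for k lam \<mu> and \<gamma> :: "'n \<Rightarrow> real"
  have "\<exists>lam \<mu> \<gamma>. KKT k lam \<mu> \<gamma>" for k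
    unfolding KKT_def by (rule NLP_KKT_point_multipliers[OF assms(1-3) assms(4,6)])
  then obtain lam \<mu> \<gamma> where KKT: "\<And>k. KKT k (lam k) (\<mu> k) (\<gamma> k)"
    by metis
  have stat: "grad f (x k) + (\<Sum>i<m. lam k i *\<^sub>R grad (g i) (x k))
      + (\<Sum>j<p. \<mu> k j *\<^sub>R grad (h j) (x k)) + (\<Sum>i\<in>UNIV. \<gamma> k i *\<^sub>R axis i 1) = 0"
    and lam: "i < m \<Longrightarrow> lam k i \<ge> 0 \<and> lam k i * g i (x k) = 0"
    and \<gamma>: "y k $ l < 1 \<Longrightarrow> \<exists>j. \<bar>\<gamma> k l\<bar> \<le> real CARD('n)^2 * (y k $ l)^2 * \<bar>\<gamma> k j\<bar>" for k i l
    using KKT[of k] unfolding KKT_def by blast+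
  \<comment> \<open>One index set for all multipliers: the objective, the \<open>g i\<close>, the
    \<open>h j\<close> and the unit vectors, in this order. The system at step \<open>k\<close> is
    then a single linear dependence.\<close>
  define S :: "(unit + nat + nat + 'n) set" where "S = UNIV <+> {..<m} <+> {..<p} <+> UNIV"
  define V :: "real^'n \<Rightarrow> unit + nat + nat + 'n \<Rightarrow> real^'n" where
    "V z = case_sum (\<lambda>_. grad f z) (case_sum (\<lambda>i. grad (g i) z)
      (case_sum (\<lambda>j. grad (h j) z) (\<lambda>i. axis i 1)))" for z
  define c :: "nat \<Rightarrow> unit + nat + nat + 'n \<Rightarrow> real" where
    "c k = case_sum (\<lambda>_. 1) (case_sum (lam k) (case_sum (\<mu> k) (\<gamma> k)))" for k
  define N where "N k = (\<Sum>s\<in>S. \<bar>c k s\<bar>)" for k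
  have S: "finite S" by (simp add: S_def)
  have sumS: "(\<Sum>s\<in>S. F s) = F (Inl ()) + (\<Sum>i<m. F (Inr (Inl i)))
      + (\<Sum>j<p. F (Inr (Inr (Inl j)))) + (\<Sum>i\<in>UNIV. F (Inr (Inr (Inr i))))"
    for F :: "_ \<Rightarrow> 'b::comm_monoid_add"
    unfolding S_def by (simp add: sum.Plus UNIV_unit add.assoc)
  have inS: "Inl () \<in> S" "i < m \<Longrightarrow> Inr (Inl i) \<in> S" "j < p \<Longrightarrow> Inr (Inr (Inl j)) \<in> S"
    "Inr (Inr (Inr l)) \<in> S" for i j l by (auto simp: S_def)
  have le_N: "\<bar>c k s\<bar> \<le> N k" if "s \<in> S" for k s
    unfolding N_def using that S by (intro member_le_sum) auto
  \<comment> \<open>The objective has coefficient 1, so \<open>N k\<close> is at least 1.\<close>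
  have Npos: "N k > 0" for k
    using le_N[OF inS(1), of k] by (simp add: c_def)
  have V: "(\<lambda>k. V (x k) s) \<longlonglongrightarrow> V xs s" if "s \<in> S" for s
    using that unfolding S_def V_def
    by (auto intro!: isCont_tendsto_compose[OF cont_differentiable_isCont_grad x] assms(1-3))
  have dep: "(\<Sum>s\<in>S. c k s *\<^sub>R V (x k) s) = 0" for k
    using stat[of k] by (simp add: sumS c_def V_def)
  obtain r d where r: "strict_mono r"
    and d: "\<And>s. s \<in> S \<Longrightarrow> (\<lambda>k. c (r k) s / N (r k)) \<longlonglongrightarrow> d s"
    and lim: "(\<Sum>s\<in>S. d s *\<^sub>R V xs s) = 0" and norm1: "(\<Sum>s\<in>S. \<bar>d s\<bar>) = 1"
    using normalised_coefficients_limit[of S "\<lambda>k. V (x k)" "V xs" c, OF S V dep, folded N_def] Npos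
    by blast
  define d0 where "d0 = d (Inl ())"
  define dl where "dl i = d (Inr (Inl i))" for i
  define dm where "dm j = d (Inr (Inr (Inl j)))" for j
  define dg where "dg i = d (Inr (Inr (Inr i)))" for i
  have d0: "d0 \<ge> 0"
    using LIMSEQ_le_const[OF d[OF inS(1)], of 0] Npos by (auto simp: d0_def c_def less_imp_le)
  have dl: "dl i \<ge> 0" "dl i * g i xs = 0" if "i < m" for i
  proof -
    note lim = d[OF inS(2)[OF that]]
    show "dl i \<ge> 0"
      using LIMSEQ_le_const[OF lim, of 0] Npos lam[OF that]
      by (auto simp: dl_def c_def less_imp_le)
    have "(\<lambda>k. c (r k) (Inr (Inl i)) / N (r k) * g i (x (r k))) \<longlonglongrightarrow> dl i * g i xs"
      unfolding dl_def using LIMSEQ_subseq_LIMSEQ[OF gx[OF that] r]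
      by (intro tendsto_mult lim) (simp add: o_def)
    moreover have "c (r k) (Inr (Inl i)) / N (r k) * g i (x (r k)) = 0" for k
      using lam[OF that, of "r k"] by (auto simp: c_def)
    ultimately show "dl i * g i xs = 0" by (simp only: LIMSEQ_const_iff)
  qed
  \<comment> \<open>Eventually \<open>y (r k) $ i < 1\<close>, so the estimate
    \<open>\<gamma>\<close> is available. Each multiplier is at most \<open>N (r k)\<close> in
    absolute value, so division by it leaves a multiple of \<open>(y (r k) $ i)^2\<close>, which
    tends to 0.\<close>
  have dg: "dg i = 0" if "ys $ i = 0" for i
  proof -
    have yr: "(\<lambda>k. y (r k) $ i) \<longlonglongrightarrow> 0"
      using LIMSEQ_subseq_LIMSEQ[OF yi r, of i] that by (simp add: o_def)
    have "(\<lambda>k. real CARD('n)^2 * (y (r k) $ i)^2) \<longlonglongrightarrow> 0"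
      using tendsto_mult_left[OF tendsto_power[OF yr, of 2], of "real CARD('n)^2"] by simp
    moreover have "\<forall>\<^sub>F k in sequentially. norm (c (r k) (Inr (Inr (Inr i))) / N (r k))
        \<le> real CARD('n)^2 * (y (r k) $ i)^2"
    proof (rule eventually_mono[OF order_tendstoD(2)[OF yr zero_less_one]])
      fix k
      assume "y (r k) $ i < 1"
      then obtain j where "\<bar>\<gamma> (r k) i\<bar> \<le> real CARD('n)^2 * (y (r k) $ i)^2 * \<bar>\<gamma> (r k) j\<bar>"
        using \<gamma> by blast
      also have "\<dots> \<le> real CARD('n)^2 * (y (r k) $ i)^2 * N (r k)"
        using le_N[OF inS(4)[of j], of "r k"] by (intro mult_left_mono) (auto simp: c_def)
      finally show "norm (c (r k) (Inr (Inr (Inr i))) / N (r k)) \<le> real CARD('n)^2 * (y (r k) $ i)^2"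
        using Npos[of "r k"] by (simp add: c_def divide_le_eq abs_of_pos)
    qed
    ultimately have "(\<lambda>k. c (r k) (Inr (Inr (Inr i))) / N (r k)) \<longlonglongrightarrow> 0"
      by (rule Lim_null_comparison[rotated])
    with d[OF inS(4)] show ?thesis unfolding dg_def by (rule LIMSEQ_unique)
  qed
  have FJ: "d0 *\<^sub>R grad f xs + (\<Sum>i<m. dl i *\<^sub>R grad (g i) xs) + (\<Sum>j<p. dm j *\<^sub>R grad (h j) xs)
      + (\<Sum>i\<in>UNIV. dg i *\<^sub>R axis i 1) = 0"
    using lim by (simp add: sumS V_def d0_def dl_def dm_def dg_def)
  have norm1': "\<bar>d0\<bar> + (\<Sum>i<m. \<bar>dl i\<bar>) + (\<Sum>j<p. \<bar>dm j\<bar>) + (\<Sum>i\<in>UNIV. \<bar>dg i\<bar>) = 1"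
    using norm1 by (simp add: sumS d0_def dl_def dm_def dg_def)
  have dl0: "dl i = 0" if "i < m" "i \<notin> I_g m g xs" for i
    using dl(2)[OF that(1)] that by (auto simp: I_g_def)
  \<comment> \<open>If \<open>xs $ i\<close> is nonzero, then \<open>ys $ i = 0\<close> by
    complementarity. So \<open>dg\<close> lives on exactly the index set over which CC-MFCQ
    sums.\<close>
  have dg0: "dg i = 0" if "i \<notin> I_0 xs" for i
    using dg xy0[of i] that by (auto simp: I_0_def)
  \<comment> \<open>Otherwise the remaining coefficients form a dependence covered by CC-MFCQ, hence
    all vanish, against the normalisation to 1.\<close>
  have "d0 \<noteq> 0"
  proof
    assume "d0 = 0"
    have "(\<Sum>i\<in>I_g m g xs. dl i *\<^sub>R grad (g i) xs) = (\<Sum>i<m. dl i *\<^sub>R grad (g i) xs)"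
      by (rule sum.mono_neutral_left) (auto simp: dl0, auto simp: I_g_def)
    moreover have "(\<Sum>i\<in>I_0 xs. dg i *\<^sub>R axis i 1 :: real^'n) = (\<Sum>i\<in>UNIV. dg i *\<^sub>R axis i 1)"
      by (rule sum.mono_neutral_left) (auto simp: dg0)
    ultimately have "(\<Sum>i\<in>I_g m g xs. dl i *\<^sub>R grad (g i) xs) + (\<Sum>j<p. dm j *\<^sub>R grad (h j) xs)
        + (\<Sum>i\<in>I_0 xs. dg i *\<^sub>R axis i 1) = 0"
      using FJ \<open>d0 = 0\<close> by simp
    moreover have "\<forall>i\<in>I_g m g xs. dl i \<ge> 0" using dl(1) by (auto simp: I_g_def)
    ultimately have "(\<forall>i\<in>I_g m g xs. dl i = 0) \<and> (\<forall>j<p. dm j = 0) \<and> (\<forall>i\<in>I_0 xs. dg i = 0)"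
      using assms(8) unfolding CC_MFCQ_def by blast
    then have "\<forall>i<m. dl i = 0" "\<forall>j<p. dm j = 0" "\<forall>i. dg i = 0"
      using dl0 dg0 by blast+
    then show False using norm1' \<open>d0 = 0\<close> by simp
  qed
  then have "d0 > 0" using d0 by simp
  \<comment> \<open>Since \<open>d0\<close> is positive, dividing by it preserves the signs of the
    \<open>dl i\<close>.\<close>
  define \<gamma>' :: "real^'n" where "\<gamma>' = (\<chi> i. dg i / d0)"
  have "grad f xs + (\<Sum>i<m. (dl i / d0) *\<^sub>R grad (g i) xs)
      + (\<Sum>j<p. (dm j / d0) *\<^sub>R grad (h j) xs)
      + (\<Sum>i\<in>UNIV. \<gamma>' $ i *\<^sub>R axis i 1) = 0"
    using arg_cong[OF FJ, of "\<lambda>v. (1 / d0) *\<^sub>R v"] \<open>d0 \<noteq> 0\<close>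
    by (simp add: scaleR_add_right scaleR_sum_right \<gamma>'_def)
  moreover have "\<forall>i<m. dl i / d0 \<ge> 0 \<and> dl i / d0 * g i xs = 0"
    using dl \<open>d0 > 0\<close> by simp
  moreover have "\<forall>i. ys $ i = 0 \<longrightarrow> \<gamma>' $ i = 0"
    using dg by (simp add: \<gamma>'_def)
  ultimately show ?thesis
    unfolding S_stationary_def using P_feas
    by (intro conjI exI[of _ "\<lambda>i. dl i / d0"] exI[of _ "\<lambda>j. dm j / d0"] exI[of _ \<gamma>'])
qed

end
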